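(* Let $T=T_n\langle i_1,\ldots,i_{k_1};j_1,\ldots,j_{k_2}\rangle$ with $k_1,k_2\ge 1$, where $i_1<\cdots<i_{k_1}$ and $j_1<\cdots<j_{k_2}$. Then the maximum row sum of $T$ is at most $2$ if and only if all of the following hold: $k_1\le 2$ and $k_2\le 2$; if $k_2=2$, then $i_1+j_2\ge n$; and if $k_1=2$, then $i_2+j_1\ge n$.
   Context: Write $[m]=\{1,\dots,m\}$. For disjoint subsets $\alpha=\{i_1<\cdots<i_{k_1}\}$ and $\beta=\{j_1<\cdots<j_{k_2}\}$ of $[n-1]$, not both empty, $T_n\langle\alpha;\beta\rangle=T_n\langle i_1,\ldots,i_{k_1};j_1,\ldots,j_{k_2}\rangle$ denotes the $n\times n$ $(0,1)$-matrix $(t_{u,v})$ with $t_{u,v}=1$ if and only if $u-v\in\alpha$ or $v-u\in\beta$. Row sums are computed in the integers. *)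

theory Defs
  imports "Jordan_Normal_Form.Matrix"
begin

(* T_n<alpha; beta>.  Library matrices are indexed from 0, which leaves the differences
   u - v unchanged; they are taken in the integers to avoid truncated subtraction. *)
definition toeplitz01 :: "nat \<Rightarrow> nat set \<Rightarrow> nat set \<Rightarrow> int mat" where
  "toeplitz01 n \<alpha> \<beta> =
     mat n n (\<lambda>(u, v). if int u - int v \<in> int ` \<alpha> \<or> int v - int u \<in> int ` \<beta> then 1 else 0)"

definition row_sum :: "int mat \<Rightarrow> nat \<Rightarrow> int" where
  "row_sum A u = (\<Sum>v<dim_col A. A $$ (u, v))"

(* Only meaningful for matrices with at least one row. *)
definition max_row_sum :: "int mat \<Rightarrow> int" where
  "max_row_sum A = Max (row_sum A ` {..<dim_row A})"

end

theory Submission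
  imports Defs
begin

text \<open>
  Let \<open>\<alpha>\<close> be the set of values of \<open>i\<close> and \<open>\<beta>\<close> the set of values of \<open>j\<close>.
  The diagonal \<open>a \<in> \<alpha>\<close> meets row \<open>u\<close> (counted from 0) in the single column \<open>u - a\<close>,
  provided \<open>a \<le> u\<close>, and the diagonal \<open>b \<in> \<beta>\<close> meets it in column \<open>u + b\<close>, provided
  \<open>b \<le> n - 1 - u\<close>. Hence the row sum is the number of elements of \<open>\<alpha>\<close> up to a threshold
  \<open>x = u\<close> plus the number of elements of \<open>\<beta>\<close> up to a threshold \<open>y\<close>, where the two
  thresholds satisfy \<open>x + y = n - 1\<close> (\<open>row_sum_toeplitz01\<close>).

  Since \<open>i\<close> is increasing, at least \<open>m \<ge> 1\<close> elements of \<open>\<alpha>\<close> are at most \<open>x\<close> exactly when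
  \<open>m \<le> k1\<close> and \<open>i m \<le> x\<close> (\<open>le_card_below_iff\<close>), and similarly for \<open>\<beta>\<close>.
  In a row of sum at least 3, the two counts are at least (3, 0), (0, 3), (2, 1) or (1, 2).
  The first two cases occur in some
  row iff \<open>k1 \<ge> 3\<close> or \<open>k2 \<ge> 3\<close>, as the last and the first row show. The third requires
  \<open>k1 \<ge> 2\<close>, \<open>i 2 \<le> x\<close> and \<open>j 1 \<le> y\<close>, and these bounds are
  compatible with \<open>x + y = n - 1\<close> iff \<open>i 2 + j 1 < n\<close>; by symmetry the fourth occurs iff
  \<open>k2 \<ge> 2\<close> and \<open>i 1 + j 2 < n\<close>.
\<close>

text \<open>
  The two families of ones occupy disjoint column sets, to the left and to the right of the
  main diagonal, because all offsets are positive.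
\<close>

lemma row_sum_toeplitz01:
  assumes u: "u < n" and pos: "0 \<notin> \<alpha>" "0 \<notin> \<beta>"
  shows "row_sum (toeplitz01 n \<alpha> \<beta>) u =
    int (card {a \<in> \<alpha>. a \<le> u} + card {b \<in> \<beta>. b \<le> n - 1 - u})"
proof -
  let ?A = "{a \<in> \<alpha>. a \<le> u}" and ?B = "{b \<in> \<beta>. b \<le> n - 1 - u}"
  let ?P = "\<lambda>v. int u - int v \<in> int ` \<alpha> \<or> int v - int u \<in> int ` \<beta>"
  have left: "int u - int v \<in> int ` \<alpha> \<longleftrightarrow> v \<in> (\<lambda>a. u - a) ` ?A" for v
  proof
    assume "int u - int v \<in> int ` \<alpha>"
    then obtain a where "a \<in> \<alpha>" "int u - int v = int a" by blast
    then have "a \<in> ?A" "v = u - a" by auto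
    then show "v \<in> (\<lambda>a. u - a) ` ?A" by blast
  next
    assume "v \<in> (\<lambda>a. u - a) ` ?A"
    then obtain a where "a \<in> \<alpha>" "a \<le> u" "v = u - a" by blast
    then have "int u - int v = int a" by simp
    with \<open>a \<in> \<alpha>\<close> show "int u - int v \<in> int ` \<alpha>" by blast
  qed
  have right: "v < n \<and> int v - int u \<in> int ` \<beta> \<longleftrightarrow> v \<in> (\<lambda>b. u + b) ` ?B" for v
  proof
    assume "v < n \<and> int v - int u \<in> int ` \<beta>"
    then obtain b where "b \<in> \<beta>" "int v - int u = int b" "v < n" by blast
    then have "b \<in> ?B" "v = u + b" by auto
    then show "v \<in> (\<lambda>b. u + b) ` ?B" by blast
  next
    assume "v \<in> (\<lambda>b. u + b) ` ?B"
    then obtain b where "b \<in> \<beta>" "b \<le> n - 1 - u" "v = u + b" by blast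
    then have "int v - int u = int b" "v < n" using u by auto
    with \<open>b \<in> \<beta>\<close> show "v < n \<and> int v - int u \<in> int ` \<beta>" by blast
  qed
  have cols: "{v \<in> {..<n}. ?P v} = (\<lambda>a. u - a) ` ?A \<union> (\<lambda>b. u + b) ` ?B"
  proof (rule Set.set_eqI)
    fix v
    have "v < n" if "v \<in> (\<lambda>a. u - a) ` ?A"
      using that u by (elim imageE) linarith
    then show "v \<in> {v \<in> {..<n}. ?P v} \<longleftrightarrow> v \<in> (\<lambda>a. u - a) ` ?A \<union> (\<lambda>b. u + b) ` ?B"
      using left[of v] right[of v] by blast
  qed
  have disj: "(\<lambda>a. u - a) ` ?A \<inter> (\<lambda>b. u + b) ` ?B = {}"
  proof -
    have "u - a \<noteq> u + b" if "b \<in> \<beta>" for a b :: nat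
      using that pos by (cases "b = 0") auto
    then show ?thesis by fastforce
  qed
  have "row_sum (toeplitz01 n \<alpha> \<beta>) u = (\<Sum>v<n. if ?P v then 1 else 0)"
    using u by (simp add: row_sum_def toeplitz01_def)
  also have "\<dots> = int (card {v \<in> {..<n}. ?P v})"
    by (simp add: sum.If_cases Int_def)
  also have "card {v \<in> {..<n}. ?P v} = card ((\<lambda>a. u - a) ` ?A) + card ((\<lambda>b. u + b) ` ?B)"
    unfolding cols using disj by (intro card_Un_disjoint) auto
  also have "card ((\<lambda>a. u - a) ` ?A) = card ?A"
    by (rule card_image) (auto simp: inj_on_def)
  also have "card ((\<lambda>b. u + b) ` ?B) = card ?B"
    by (rule card_image) (auto simp: inj_on_def)
  finally show ?thesis .
qed

text \<open>
  As \<open>f\<close> enumerates its values in increasing order, those up to \<open>x\<close> form an initial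
  segment of the enumeration, so there are at least \<open>m\<close> of them iff \<open>f m\<close> is one.
\<close>

lemma le_card_below_iff:
  fixes f :: "nat \<Rightarrow> 'a :: linorder"
  assumes mono: "strict_mono_on {1..k} f" and m: "m \<ge> 1"
  shows "m \<le> card {a \<in> f ` {1..k}. a \<le> x} \<longleftrightarrow> m \<le> k \<and> f m \<le> x"
proof
  assume le: "m \<le> card {a \<in> f ` {1..k}. a \<le> x}"
  have "card {a \<in> f ` {1..k}. a \<le> x} \<le> card (f ` {1..k})"
    by (intro card_mono) auto
  also have "\<dots> \<le> k"
    using card_image_le[of "{1..k}" f] by simp
  finally have mk: "m \<le> k" using le by simp
  have "f m \<le> x"
  proof (rule ccontr)
    assume x: "\<not> f m \<le> x"
    have "p < m" if "p \<in> {1..k}" "f p \<le> x" for p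
    proof (rule ccontr)
      assume "\<not> p < m"
      then have "f m \<le> f p"
        using strict_mono_on_leD[OF mono, of m p] that m mk by auto
      with x that show False by simp
    qed
    then have "{a \<in> f ` {1..k}. a \<le> x} \<subseteq> f ` {1..<m}" by auto
    then have "card {a \<in> f ` {1..k}. a \<le> x} \<le> card (f ` {1..<m})"
      by (intro card_mono) auto
    also have "\<dots> \<le> m - 1"
      using card_image_le[of "{1..<m}" f] by simp
    finally show False using le m by simp
  qed
  with mk show "m \<le> k \<and> f m \<le> x" ..
next
  assume r: "m \<le> k \<and> f m \<le> x"
  have "f p \<le> x" if "p \<in> {1..m}" for p
    using strict_mono_on_leD[OF mono, of p m] that r by auto
  then have "f ` {1..m} \<subseteq> {a \<in> f ` {1..k}. a \<le> x}" using r by auto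
  then have "card (f ` {1..m}) \<le> card {a \<in> f ` {1..k}. a \<le> x}"
    by (intro card_mono) auto
  moreover have "inj_on f {1..m}"
    using strict_mono_on_imp_inj_on[OF mono] r by (auto intro: inj_on_subset)
  ultimately show "m \<le> card {a \<in> f ` {1..k}. a \<le> x}"
    by (simp add: card_image)
qed

theorem theorem2p7:
  fixes n k1 k2 :: nat and i j :: "nat \<Rightarrow> nat"
  assumes "k1 \<ge> 1" and "k2 \<ge> 1"
    and "strict_mono_on {1..k1} i" and "strict_mono_on {1..k2} j"
    and "i ` {1..k1} \<subseteq> {1..n - 1}" and "j ` {1..k2} \<subseteq> {1..n - 1}"
    and "i ` {1..k1} \<inter> j ` {1..k2} = {}"
  shows "max_row_sum (toeplitz01 n (i ` {1..k1}) (j ` {1..k2})) \<le> 2 \<longleftrightarrow>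
    k1 \<le> 2 \<and> k2 \<le> 2 \<and>
    (k2 = 2 \<longrightarrow> i 1 + j 2 \<ge> n) \<and>
    (k1 = 2 \<longrightarrow> i 2 + j 1 \<ge> n)"
proof -
  let ?T = "toeplitz01 n (i ` {1..k1}) (j ` {1..k2})"
  define p where "p x = card {a \<in> i ` {1..k1}. a \<le> x}" for x
  define q where "q x = card {b \<in> j ` {1..k2}. b \<le> x}" for x
  have p_ge: "m \<le> p x \<longleftrightarrow> m \<le> k1 \<and> i m \<le> x" if "m \<ge> 1" for m x
    unfolding p_def using le_card_below_iff[OF assms(3) that] .
  have q_ge: "m \<le> q x \<longleftrightarrow> m \<le> k2 \<and> j m \<le> x" if "m \<ge> 1" for m x
    unfolding q_def using le_card_below_iff[OF assms(4) that] .
  have i_le: "i m \<le> n - 1" if "1 \<le> m" "m \<le> k1" for m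
    using subsetD[OF assms(5) imageI, of m] that by simp
  have j_le: "j m \<le> n - 1" if "1 \<le> m" "m \<le> k2" for m
    using subsetD[OF assms(6) imageI, of m] that by simp
  have n: "n > 0"
    using subsetD[OF assms(5) imageI, of 1] assms(1) by auto
  have rs: "row_sum ?T u = int (p u + q (n - 1 - u))" if "u < n" for u
    unfolding p_def q_def
  proof (rule row_sum_toeplitz01[OF that])
    show "0 \<notin> i ` {1..k1}" using assms(5) by (meson atLeastAtMost_iff not_one_le_zero subsetD)
    show "0 \<notin> j ` {1..k2}" using assms(6) by (meson atLeastAtMost_iff not_one_le_zero subsetD)
  qed
  have "max_row_sum ?T \<le> 2 \<longleftrightarrow> (\<forall>u<n. row_sum ?T u \<le> 2)"
    unfolding max_row_sum_def using n by (subst Max_le_iff) (auto simp: toeplitz01_def)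
  also have "\<dots> \<longleftrightarrow> (\<forall>u<n. \<not> 3 \<le> p u + q (n - 1 - u))"
    using rs by (auto simp: not_le)
  also have "\<dots> \<longleftrightarrow> k1 \<le> 2 \<and> k2 \<le> 2 \<and> (k2 = 2 \<longrightarrow> i 1 + j 2 \<ge> n) \<and>
      (k1 = 2 \<longrightarrow> i 2 + j 1 \<ge> n)" (is "?rows \<longleftrightarrow> ?cond")
  proof
    assume rows: ?rows
    have k1: "k1 \<le> 2"
    proof (rule ccontr)
      assume "\<not> k1 \<le> 2"
      then have "3 \<le> p (n - 1)" using p_ge[of 3] i_le[of 3] by simp
      with rows[rule_format, of "n - 1"] n show False by simp
    qed
    have k2: "k2 \<le> 2"
    proof (rule ccontr)
      assume "\<not> k2 \<le> 2"
      then have "3 \<le> q (n - 1)" using q_ge[of 3] j_le[of 3] by simp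
      with rows[rule_format, of 0] n show False by simp
    qed
    \<comment> \<open>The row that first meets the relevant diagonals on the left leaves the largest
        possible threshold on the right.\<close>
    have "i 1 + j 2 \<ge> n" if "k2 = 2"
    proof (rule ccontr)
      assume lt: "\<not> i 1 + j 2 \<ge> n"
      then have "1 \<le> p (i 1)" "2 \<le> q (n - 1 - i 1)"
        using p_ge[of 1 "i 1"] q_ge[of 2 "n - 1 - i 1"] assms(1) that by auto
      with rows[rule_format, of "i 1"] lt show False by simp
    qed
    moreover have "i 2 + j 1 \<ge> n" if "k1 = 2"
    proof (rule ccontr)
      assume lt: "\<not> i 2 + j 1 \<ge> n"
      then have "2 \<le> p (i 2)" "1 \<le> q (n - 1 - i 2)"
        using p_ge[of 2 "i 2"] q_ge[of 1 "n - 1 - i 2"] assms(2) that by auto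
      with rows[rule_format, of "i 2"] lt show False by simp
    qed
    ultimately show ?cond using k1 k2 by blast
  next
    assume cond: ?cond
    show ?rows
    proof (intro allI impI notI)
      fix u assume u: "u < n" and "3 \<le> p u + q (n - 1 - u)"
      then consider "3 \<le> p u" | "3 \<le> q (n - 1 - u)"
        | "2 \<le> p u" "1 \<le> q (n - 1 - u)" | "1 \<le> p u" "2 \<le> q (n - 1 - u)"
        by linarith
      then show False
      proof cases
        case 1
        then show False using cond p_ge[of 3 u] by simp
      next
        case 2
        then show False using cond q_ge[of 3 "n - 1 - u"] by simp
      next
        case 3
        then have "k1 = 2" "i 2 \<le> u" "j 1 \<le> n - 1 - u"
          using cond p_ge[of 2 u] q_ge[of 1 "n - 1 - u"] by auto
        then show False using cond u by linarith
      next
        case 4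
        then have "k2 = 2" "i 1 \<le> u" "j 2 \<le> n - 1 - u"
          using cond p_ge[of 1 u] q_ge[of 2 "n - 1 - u"] by auto
        then show False using cond u by linarith
      qed
    qed
  qed
  finally show ?thesis .
qed

end
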